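(* Let $\mathcal{V}$ be a finite ground set, let $k\ge 2$ and $1\le\tau\le k$ be integers with $|\mathcal{V}|\ge k$, and let $h:\mathcal{H}(\mathcal{V})\to\mathbb{R}_{\ge 0}$ with $h(())=0$ be forward-monotone, backward-monotone and general-sequence-submodular. Let $S$ be the sequence output by Algorithm 2 with parameters $k,\tau$. Then $$\min_{\mathcal{V}'\subseteq\mathcal{V}(S),\,|\mathcal{V}'|\le \tau} h(S-\mathcal{V}')\;\ge\;\frac{1-1/e}{1+\tau}\cdot\max_{S'\in\mathcal{H}(\mathcal{V}),\,|S'|\le k}\ \min_{\mathcal{V}'\subseteq\mathcal{V}(S'),\,|\mathcal{V}'|\le \tau} h(S'-\mathcal{V}').$$
   Context: $\mathcal{H}(\mathcal{V})$ denotes the set of all finite sequences $(v_1,\dots,v_m)$ of pairwise distinct elements of $\mathcal{V}$ ($0\le m\le|\mathcal{V}|$), including the empty sequence $()$. For $S\in\mathcal{H}(\mathcal{V})$, $\mathcal{V}(S)$ is the set of its elements and $|S|=|\mathcal{V}(S)|$. For a set $\mathcal{U}$, $S-\mathcal{U}$ is the sequence obtained from $S$ by deleting the elements of $\mathcal{U}$ and keeping the order of the remaining elements; $S_1$ is a subsequence of $S_2$ if $S_1=S_2-\mathcal{U}$ for some $\mathcal{U}\subseteq\mathcal{V}(S_2)$. For $S_1=(v_1,\dots,v_{m_1})$ and $S_2\in\mathcal{H}(\mathcal{V})$ with $S_2-\mathcal{V}(S_1)=(w_1,\dots,w_{m_3})$, the concatenation is $S_1\oplus S_2=(v_1,\dots,v_{m_1},w_1,\dots,w_{m_3})$.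 Marginal value: $h(S_2\mid S_1)=h(S_1\oplus S_2)-h(S_1)$; $(v)$ is the one-element sequence. $h$ is forward-monotone if $h(S_1\oplus S_2)\ge h(S_1)$ for all $S_1,S_2$; backward-monotone if $h(S_1\oplus S_2)\ge h(S_2)$ for all $S_1,S_2$; general-sequence-submodular if $h(S_3\mid S_1)\ge h(S_3\mid S_2)$ for all $S_3$ and all $S_1,S_2$ such that $S_1$ is a subsequence of $S_2$. Algorithm 2 (parameters $k$, $\tau$): Step 1: start with $S_1=()$ and, while $|S_1|<\tau$, set $S_1=S_1\oplus(v)$ with $v\in\arg\max_{v\in\mathcal{V}\setminus\mathcal{V}(S_1)}h((v))$. Step 2: start with $S_2=()$ and, while $|S_2|<k-\tau$, set $S_2=S_2\oplus(v)$ with $v\in\arg\max_{v\in\mathcal{V}\setminus(\mathcal{V}(S_1)\cup\mathcal{V}(S_2))}h((v)\mid S_2)$. Output $S=S_1\oplus S_2$. Ties are broken arbitrarily. *)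

theory Defs
  imports Complex_Main
begin

definition seqs :: "'a set \<Rightarrow> 'a list set" where
  "seqs V = {S. distinct S \<and> set S \<subseteq> V}"

definition del :: "'a list \<Rightarrow> 'a set \<Rightarrow> 'a list"  (infixl \<open>\<ominus>\<close> 65) where
  "S \<ominus> U = filter (\<lambda>v. v \<notin> U) S"

definition is_subsequence :: "'a list \<Rightarrow> 'a list \<Rightarrow> bool" where
  "is_subsequence S1 S2 \<longleftrightarrow> (\<exists>U \<subseteq> set S2. S1 = S2 \<ominus> U)"

definition seq_concat :: "'a list \<Rightarrow> 'a list \<Rightarrow> 'a list"  (infixl \<open>\<oplus>\<close> 65) where
  "S1 \<oplus> S2 = S1 @ (S2 \<ominus> set S1)"

text \<open>\<open>marginal h S2 S1\<close> is \<open>h(S2 | S1)\<close>, the value of appending \<open>S2\<close> to \<open>S1\<close>.\<close>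

definition marginal :: "('a list \<Rightarrow> real) \<Rightarrow> 'a list \<Rightarrow> 'a list \<Rightarrow> real" where
  "marginal h S2 S1 = h (S1 \<oplus> S2) - h S1"

definition forward_monotone :: "'a set \<Rightarrow> ('a list \<Rightarrow> real) \<Rightarrow> bool" where
  "forward_monotone V h \<longleftrightarrow> (\<forall>S1 \<in> seqs V. \<forall>S2 \<in> seqs V. h (S1 \<oplus> S2) \<ge> h S1)"

definition backward_monotone :: "'a set \<Rightarrow> ('a list \<Rightarrow> real) \<Rightarrow> bool" where
  "backward_monotone V h \<longleftrightarrow> (\<forall>S1 \<in> seqs V. \<forall>S2 \<in> seqs V. h (S1 \<oplus> S2) \<ge> h S2)"

definition general_sequence_submodular :: "'a set \<Rightarrow> ('a list \<Rightarrow> real) \<Rightarrow> bool" where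
  "general_sequence_submodular V h \<longleftrightarrow>
     (\<forall>S1 \<in> seqs V. \<forall>S2 \<in> seqs V. \<forall>S3 \<in> seqs V.
        is_subsequence S1 S2 \<longrightarrow> marginal h S3 S1 \<ge> marginal h S3 S2)"

text \<open>
  The two loops of the algorithm are given by the sets of loop states reachable under
  some resolution of the argmax ties; a run's result is a reachable state at which the
  loop condition fails.
\<close>

inductive step1_state :: "'a set \<Rightarrow> ('a list \<Rightarrow> real) \<Rightarrow> nat \<Rightarrow> 'a list \<Rightarrow> bool"
  for V h \<tau> where
  init1: "step1_state V h \<tau> []"
| iter1: "\<lbrakk>step1_state V h \<tau> S1; card (set S1) < \<tau>;
           is_arg_max (\<lambda>v. h [v]) (\<lambda>v. v \<in> V - set S1) v\<rbrakk>
          \<Longrightarrow> step1_state V h \<tau> (S1 \<oplus> [v])"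

inductive step2_state ::
    "'a set \<Rightarrow> ('a list \<Rightarrow> real) \<Rightarrow> nat \<Rightarrow> nat \<Rightarrow> 'a list \<Rightarrow> 'a list \<Rightarrow> bool"
  for V h k \<tau> S1 where
  init2: "step2_state V h k \<tau> S1 []"
| iter2: "\<lbrakk>step2_state V h k \<tau> S1 S2; card (set S2) < k - \<tau>;
           is_arg_max (\<lambda>v. marginal h [v] S2) (\<lambda>v. v \<in> V - (set S1 \<union> set S2)) v\<rbrakk>
          \<Longrightarrow> step2_state V h k \<tau> S1 (S2 \<oplus> [v])"

definition algorithm2_output ::
    "'a set \<Rightarrow> ('a list \<Rightarrow> real) \<Rightarrow> nat \<Rightarrow> nat \<Rightarrow> 'a list \<Rightarrow> bool" where
  "algorithm2_output V h k \<tau> S \<longleftrightarrow>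
     (\<exists>S1 S2. step1_state V h \<tau> S1 \<and> \<not> card (set S1) < \<tau> \<and>
              step2_state V h k \<tau> S1 S2 \<and> \<not> card (set S2) < k - \<tau> \<and>
              S = S1 \<oplus> S2)"

definition robust_value :: "('a list \<Rightarrow> real) \<Rightarrow> nat \<Rightarrow> 'a list \<Rightarrow> real" where
  "robust_value h \<tau> S = Min ((\<lambda>V'. h (S \<ominus> V')) ` {V'. V' \<subseteq> set S \<and> card V' \<le> \<tau>})"

end

theory Submission
  imports Defs "HOL-Library.Sublist"
begin

text \<open>
  Both loops build a list greedily: \<open>S1\<close> for the fixed weights \<open>h [v]\<close>, \<open>S2\<close> for the marginal
  values of \<open>h\<close> among the elements outside \<open>S1\<close>. Let \<open>S'\<close> be an optimal sequence. Deleting from it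
  its elements in \<open>S1\<close>, and further ones up to a total of \<open>\<tau>\<close>, leaves at most \<open>k - \<tau>\<close> elements
  outside \<open>S1\<close>, worth at least the optimal robust value; comparing with this remainder, the usual
  greedy argument bounds \<open>h S2\<close> from below by \<open>1 - 1/e\<close> times the optimum.

  It remains to lose at most a factor \<open>1 + \<tau>\<close> in passing from \<open>S2\<close> to \<open>D = (S1 @ S2) \<ominus> U\<close>, where
  \<open>card U \<le> \<tau>\<close>. By submodularity, \<open>h S2 \<le> h (S2 \<ominus> U) + (\<Sum>u\<in>set S2 \<inter> U. h [u])\<close>. The first term is
  at most \<open>h D\<close> by backward monotonicity. If \<open>U\<close> contains an element \<open>u\<close> of \<open>S2\<close>, it cannot exhaust
  \<open>S1\<close>, and an element \<open>a\<close> of \<open>S1\<close> that survives in \<open>D\<close> gives \<open>h [u] \<le> h [a] \<le> h D\<close>.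
\<close>

lemma seqs_mono: "S \<in> seqs W \<Longrightarrow> W \<subseteq> V \<Longrightarrow> S \<in> seqs V"
  by (auto simp: seqs_def)

lemma finite_seqs: "finite V \<Longrightarrow> finite (seqs V)"
  using finite_subset_distinct[of V] by (simp add: seqs_def conj_commute)

lemma length_eq_card_seqs: "S \<in> seqs V \<Longrightarrow> length S = card (set S)"
  by (simp add: seqs_def distinct_card)

lemma Nil_in_seqs [simp]: "[] \<in> seqs V"
  by (simp add: seqs_def)

lemma singleton_in_seqs_iff [simp]: "[v] \<in> seqs V \<longleftrightarrow> v \<in> V"
  by (simp add: seqs_def)

lemma append_in_seqs_iff:
  "A @ B \<in> seqs V \<longleftrightarrow> A \<in> seqs V \<and> B \<in> seqs V \<and> set A \<inter> set B = {}"
  by (auto simp: seqs_def)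

lemma set_del [simp]: "set (S \<ominus> U) = set S - U"
  by (auto simp: del_def)

lemma del_in_seqs: "S \<in> seqs V \<Longrightarrow> S \<ominus> U \<in> seqs V"
  by (auto simp: seqs_def del_def)

lemma del_append: "(A @ B) \<ominus> U = (A \<ominus> U) @ (B \<ominus> U)"
  by (simp add: del_def)

lemma del_set_self [simp]: "S \<ominus> set S = []"
  by (simp add: del_def)

lemma seq_concat_Nil [simp]: "A \<oplus> [] = A" "[] \<oplus> T = T"
  by (simp_all add: seq_concat_def del_def)

lemma seq_concat_in_seqs: "A \<in> seqs V \<Longrightarrow> T \<in> seqs V \<Longrightarrow> A \<oplus> T \<in> seqs V"
  by (auto simp: seqs_def seq_concat_def del_def)

lemma seq_concat_eq_append: "set A \<inter> set T = {} \<Longrightarrow> A \<oplus> T = A @ T"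
  by (auto simp: seq_concat_def del_def filter_id_conv)

lemma seq_concat_snoc: "t \<notin> set T \<Longrightarrow> A \<oplus> (T @ [t]) = (A \<oplus> T) \<oplus> [t]"
  by (auto simp: seq_concat_def del_def)

lemma is_subsequence_del: "is_subsequence (S \<ominus> U) S"
proof -
  have "S \<ominus> U = S \<ominus> (U \<inter> set S)"
    unfolding del_def by (rule filter_cong) auto
  then show ?thesis
    unfolding is_subsequence_def by blast
qed

lemma is_subsequence_seq_concat_del: "is_subsequence (A \<oplus> (T \<ominus> U)) (A \<oplus> T)"
proof -
  have "A \<ominus> (U - set A) = A"
    by (auto simp: del_def filter_id_conv)
  moreover have "(T \<ominus> set A) \<ominus> (U - set A) = (T \<ominus> U) \<ominus> set A"
    unfolding del_def filter_filter by (rule filter_cong) auto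
  ultimately have "(A \<oplus> T) \<ominus> (U - set A) = A \<oplus> (T \<ominus> U)"
    by (simp add: seq_concat_def del_append)
  then show ?thesis
    by (metis is_subsequence_del)
qed

lemma is_subsequence_seq_concat: "is_subsequence A (A \<oplus> T)"
  using is_subsequence_seq_concat_del[of A T "set T"] by simp


subsection \<open>Robust values\<close>

lemma le_robust_value_iff:
  "c \<le> robust_value h \<tau> S \<longleftrightarrow> (\<forall>U. U \<subseteq> set S \<longrightarrow> card U \<le> \<tau> \<longrightarrow> c \<le> h (S \<ominus> U))"
proof -
  define F where "F = {U. U \<subseteq> set S \<and> card U \<le> \<tau>}"
  have "finite F" and "{} \<in> F"
    by (auto simp: F_def)
  then have "c \<le> Min ((\<lambda>U. h (S \<ominus> U)) ` F) \<longleftrightarrow> (\<forall>U\<in>F. c \<le> h (S \<ominus> U))"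
    by (subst Min_ge_iff) auto
  then show ?thesis
    unfolding robust_value_def F_def by blast
qed

lemma robust_value_le_avoiding:
  assumes S: "S \<in> seqs V" and A: "finite A" "card A \<le> \<tau>"
  obtains R where "R \<in> seqs (V - A)" "length R \<le> length S - \<tau>" "robust_value h \<tau> S \<le> h R"
proof -
  have "card (set S \<inter> A) \<le> min \<tau> (card (set S))"
    using A card_mono[of A "set S \<inter> A"] card_mono[of "set S" "set S \<inter> A"] by auto
  then obtain U where U: "set S \<inter> A \<subseteq> U" "U \<subseteq> set S" "card U = min \<tau> (card (set S))"
    using exists_subset_between[of "set S \<inter> A" "min \<tau> (card (set S))" "set S"] by auto
  have R: "S \<ominus> U \<in> seqs (V - A)"
    using S U(1) by (auto simp: seqs_def del_def)
  moreover have "length (S \<ominus> U) \<le> length S - \<tau>"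
    using U length_eq_card_seqs[OF S] length_eq_card_seqs[OF R]
    by (simp add: card_Diff_subset finite_subset)
  moreover have "robust_value h \<tau> S \<le> h (S \<ominus> U)"
    using U le_robust_value_iff[of "robust_value h \<tau> S" h \<tau> S] by simp
  ultimately show thesis
    by (rule that)
qed


subsection \<open>Greedy lists\<close>

inductive greedy_list :: "('a list \<Rightarrow> 'a \<Rightarrow> 'b::linorder) \<Rightarrow> 'a set \<Rightarrow> 'a list \<Rightarrow> bool"
  for gain W where
  Nil: "greedy_list gain W []"
| snoc: "\<lbrakk>greedy_list gain W S; is_arg_max (gain S) (\<lambda>v. v \<in> W - set S) v\<rbrakk>
    \<Longrightarrow> greedy_list gain W (S @ [v])"

lemma greedy_list_in_seqs: "greedy_list gain W S \<Longrightarrow> S \<in> seqs W"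
  by (induction rule: greedy_list.induct) (auto simp: append_in_seqs_iff is_arg_max_linorder)

lemma greedy_list_const_ge:
  assumes "greedy_list (\<lambda>_. f) W S" "a \<in> set S" "w \<in> W - set S"
  shows "f w \<le> f a"
  using assms by (induction rule: greedy_list.induct) (auto simp: is_arg_max_linorder)

lemma step1_state_greedy_list:
  assumes "step1_state V h \<tau> S"
  shows "greedy_list (\<lambda>_ v. h [v]) V S \<and> length S \<le> \<tau>"
  using assms
proof induction
  case init1
  show ?case by (simp add: greedy_list.Nil)
next
  case (iter1 S v)
  then have "greedy_list (\<lambda>_ v. h [v]) V (S @ [v])"
    by (blast intro: greedy_list.snoc)
  moreover have "v \<notin> set S" and "length S = card (set S)"
    using iter1 by (auto simp: is_arg_max_def dest: greedy_list_in_seqs length_eq_card_seqs)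
  ultimately show ?case
    using iter1.hyps by (simp add: seq_concat_eq_append)
qed

lemma step2_state_greedy_list:
  assumes "step2_state V h k \<tau> S1 S"
  shows "greedy_list (\<lambda>S v. marginal h [v] S) (V - set S1) S \<and> length S \<le> k - \<tau>"
  using assms
proof induction
  case init2
  show ?case by (simp add: greedy_list.Nil)
next
  case (iter2 S v)
  then have "is_arg_max (\<lambda>v. marginal h [v] S) (\<lambda>v. v \<in> V - set S1 - set S) v"
    by (simp add: is_arg_max_def)
  then have "greedy_list (\<lambda>S v. marginal h [v] S) (V - set S1) (S @ [v])"
    using iter2.IH by (blast intro: greedy_list.snoc)
  moreover have "v \<notin> set S" and "length S = card (set S)"
    using iter2 by (auto simp: is_arg_max_def dest: greedy_list_in_seqs length_eq_card_seqs)
  ultimately show ?case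
    using iter2.hyps by (simp add: seq_concat_eq_append)
qed

lemma algorithm2_outputE:
  assumes "algorithm2_output V h k \<tau> S"
  obtains S1 S2 where
    "greedy_list (\<lambda>_ v. h [v]) V S1" "length S1 = \<tau>"
    "greedy_list (\<lambda>S v. marginal h [v] S) (V - set S1) S2" "length S2 = k - \<tau>"
    "S = S1 @ S2"
proof -
  obtain S1 S2 where run: "step1_state V h \<tau> S1" "\<not> card (set S1) < \<tau>"
      "step2_state V h k \<tau> S1 S2" "\<not> card (set S2) < k - \<tau>"
    and S: "S = S1 \<oplus> S2"
    using assms by (auto simp: algorithm2_output_def)
  have S1: "greedy_list (\<lambda>_ v. h [v]) V S1" "length S1 \<le> \<tau>"
    using step1_state_greedy_list[OF run(1)] by auto
  have S2: "greedy_list (\<lambda>S v. marginal h [v] S) (V - set S1) S2" "length S2 \<le> k - \<tau>"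
    using step2_state_greedy_list[OF run(3)] by auto
  note seqs = greedy_list_in_seqs[OF S1(1)] greedy_list_in_seqs[OF S2(1)]
  have "length S1 = \<tau>" "length S2 = k - \<tau>"
    using run(2,4) S1(2) S2(2) seqs[THEN length_eq_card_seqs] by auto
  moreover have "S = S1 @ S2"
    unfolding S using seqs(2) by (intro seq_concat_eq_append) (auto simp: seqs_def)
  ultimately show thesis
    using S1(1) S2(1) that by blast
qed


subsection \<open>Submodular sequence functions\<close>

lemma marginal_antimono:
  assumes "general_sequence_submodular V h"
    and "A \<in> seqs V" "B \<in> seqs V" "T \<in> seqs V" "is_subsequence A B"
  shows "marginal h T B \<le> marginal h T A"
  using assms by (simp add: general_sequence_submodular_def)

lemma seq_concat_le_del_plus_marginals:
  assumes submodular: "general_sequence_submodular V h" and A: "A \<in> seqs V" and "T \<in> seqs V"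
  shows "h (A \<oplus> T) \<le> h (A \<oplus> (T \<ominus> U)) + (\<Sum>u\<in>set T \<inter> U. marginal h [u] A)"
  using \<open>T \<in> seqs V\<close>
proof (induction T rule: rev_induct)
  case Nil
  show ?case by (simp add: del_def)
next
  case (snoc v T)
  then have T: "T \<in> seqs V" and v: "v \<in> V" "v \<notin> set T"
    by (auto simp: append_in_seqs_iff)
  note AT = seq_concat_in_seqs[OF A T]
  have split: "h (A \<oplus> (T @ [v])) = h (A \<oplus> T) + marginal h [v] (A \<oplus> T)"
    using v by (simp add: seq_concat_snoc marginal_def)
  show ?case
  proof (cases "v \<in> U")
    case True
    have "marginal h [v] (A \<oplus> T) \<le> marginal h [v] A"
      using A AT v(1) by (intro marginal_antimono[OF submodular] is_subsequence_seq_concat) simp_all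
    moreover have "(T @ [v]) \<ominus> U = T \<ominus> U" "set (T @ [v]) \<inter> U = insert v (set T \<inter> U)"
      using True by (auto simp: del_def)
    ultimately show ?thesis
      using snoc.IH[OF T] v(2) split by simp
  next
    case False
    have "marginal h [v] (A \<oplus> T) \<le> marginal h [v] (A \<oplus> (T \<ominus> U))"
      using A T AT v(1)
      by (intro marginal_antimono[OF submodular] is_subsequence_seq_concat_del seq_concat_in_seqs
          del_in_seqs) simp_all
    moreover have "(T @ [v]) \<ominus> U = (T \<ominus> U) @ [v]" "set (T @ [v]) \<inter> U = set T \<inter> U"
      using False by (auto simp: del_def)
    ultimately show ?thesis
      using snoc.IH[OF T] v(2) split by (simp add: seq_concat_snoc marginal_def)
  qed
qed

locale monotone_sequence_submodular =
  fixes V :: "'a set" and h :: "'a list \<Rightarrow> real"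
  assumes forward: "forward_monotone V h"
    and backward: "backward_monotone V h"
    and submodular: "general_sequence_submodular V h"
begin

lemma marginal_nonneg: "S \<in> seqs V \<Longrightarrow> T \<in> seqs V \<Longrightarrow> 0 \<le> marginal h T S"
  using forward by (simp add: marginal_def forward_monotone_def)

lemma le_seq_concat: "S \<in> seqs V \<Longrightarrow> T \<in> seqs V \<Longrightarrow> h T \<le> h (S \<oplus> T)"
  using backward by (simp add: backward_monotone_def)

lemma sublist_le:
  assumes "S \<in> seqs V" "sublist R S"
  shows "h R \<le> h S"
proof -
  obtain A B where S: "S = A @ R @ B"
    using assms(2) by (auto simp: sublist_def)
  have "A \<in> seqs V" "R \<in> seqs V" "B \<in> seqs V" "R @ B \<in> seqs V"
    using assms(1) by (auto simp: S append_in_seqs_iff)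
  moreover have "R \<oplus> B = R @ B" "A \<oplus> (R @ B) = S"
    using assms(1) by (auto simp: S append_in_seqs_iff intro!: seq_concat_eq_append)
  ultimately show ?thesis
    using marginal_nonneg[of R B] le_seq_concat[of A "R @ B"] by (simp add: marginal_def)
qed

lemma Nil_le: "S \<in> seqs V \<Longrightarrow> h [] \<le> h S"
  by (simp add: sublist_le)

lemma singleton_le: "S \<in> seqs V \<Longrightarrow> a \<in> set S \<Longrightarrow> h [a] \<le> h S"
  by (rule sublist_le) (auto simp: sublist_def dest: split_list)

lemma gap_le_greedy_marginal:
  assumes S: "S \<in> seqs V" and T: "T \<in> seqs W" and "W \<subseteq> V"
    and v: "is_arg_max (\<lambda>v. marginal h [v] S) (\<lambda>v. v \<in> W - set S) v"
  shows "h T - h S \<le> real (length T) * marginal h [v] S"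
proof -
  have TV: "T \<in> seqs V"
    using T \<open>W \<subseteq> V\<close> by (rule seqs_mono)
  have "marginal h [t] S \<le> marginal h [v] S" if "t \<in> set T" for t
  proof (cases "t \<in> set S")
    case True
    then have "marginal h [t] S = 0"
      by (simp add: marginal_def seq_concat_def del_def)
    also have "\<dots> \<le> marginal h [v] S"
      using S v \<open>W \<subseteq> V\<close> by (intro marginal_nonneg) (auto simp: is_arg_max_def)
    finally show ?thesis .
  next
    case False
    then show ?thesis
      using that T v by (auto simp: seqs_def is_arg_max_linorder)
  qed
  then have "(\<Sum>t\<in>set T. marginal h [t] S) \<le> real (card (set T)) * marginal h [v] S"
    by (rule sum_bounded_above)
  moreover have "h T \<le> h (S \<oplus> T)"
    using S TV by (rule le_seq_concat)
  moreover have "h (S \<oplus> T) \<le> h S + (\<Sum>t\<in>set T. marginal h [t] S)"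
    using seq_concat_le_del_plus_marginals[OF submodular S TV, of "set T"] by simp
  ultimately show ?thesis
    by (simp add: length_eq_card_seqs[OF T])
qed

text \<open>For \<open>T = []\<close> the factor is \<open>1\<close> because \<open>1 / 0 = 0\<close>, and the right-hand side vanishes.\<close>

lemma greedy_list_gap:
  assumes "greedy_list (\<lambda>S v. marginal h [v] S) W S" and T: "T \<in> seqs W" and "W \<subseteq> V"
  shows "h T - h S \<le> (1 - 1 / real (length T)) ^ length S * (h T - h [])"
  using assms(1)
proof induction
  case Nil
  show ?case by simp
next
  case (snoc S v)
  define q where "q = 1 - 1 / real (length T)"
  have "0 \<le> q"
    by (cases "length T") (simp_all add: q_def)
  have S: "S \<in> seqs V"
    using snoc.hyps(1) \<open>W \<subseteq> V\<close> by (blast intro: seqs_mono greedy_list_in_seqs)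
  have v: "v \<in> V" "v \<notin> set S"
    using snoc.hyps(2) \<open>W \<subseteq> V\<close> by (auto simp: is_arg_max_def)
  have "(h T - h S) / real (length T) \<le> marginal h [v] S"
    using gap_le_greedy_marginal[OF S T \<open>W \<subseteq> V\<close> snoc.hyps(2)] marginal_nonneg[OF S] v(1)
    by (simp add: divide_le_eq mult.commute)
  then have "h T - h (S @ [v]) \<le> q * (h T - h S)"
    using v(2) by (simp add: q_def marginal_def seq_concat_eq_append algebra_simps diff_divide_distrib)
  also have "\<dots> \<le> q * (q ^ length S * (h T - h []))"
    using snoc.IH \<open>0 \<le> q\<close> unfolding q_def by (rule mult_left_mono)
  finally show ?case
    by (simp add: q_def mult.assoc)
qed

lemma greedy_list_value_ge:
  assumes S: "greedy_list (\<lambda>S v. marginal h [v] S) W S"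
    and T: "T \<in> seqs W" "length T \<le> length S" and "W \<subseteq> V" and "0 \<le> h []"
  shows "(1 - 1 / exp 1) * h T \<le> h S"
proof -
  have gap_nonneg: "0 \<le> h T - h []"
    using Nil_le[OF seqs_mono] T(1) \<open>W \<subseteq> V\<close> by simp
  have "h T - h S \<le> 1 / exp 1 * (h T - h [])"
  proof (cases "T = []")
    case True
    then show ?thesis
      using Nil_le[OF seqs_mono] greedy_list_in_seqs[OF S] \<open>W \<subseteq> V\<close> by simp
  next
    case False
    define n where "n = length T"
    have "n > 0"
      using False by (simp add: n_def)
    have "(1 - 1 / real n) ^ length S \<le> (1 - 1 / real n) ^ n"
      using T(2) \<open>n > 0\<close> by (intro power_decreasing) (simp_all add: n_def Suc_le_eq)
    also have "\<dots> \<le> exp (- 1)"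
      using \<open>n > 0\<close> by (intro exp_ge_one_minus_x_over_n_power_n) auto
    also have "\<dots> = 1 / exp 1"
      by (simp add: exp_minus inverse_eq_divide)
    finally have "(1 - 1 / real n) ^ length S * (h T - h []) \<le> 1 / exp 1 * (h T - h [])"
      using gap_nonneg by (rule mult_right_mono)
    then show ?thesis
      using greedy_list_gap[OF S T(1) \<open>W \<subseteq> V\<close>] by (simp add: n_def)
  qed
  also have "\<dots> \<le> 1 / exp 1 * h T"
    using \<open>0 \<le> h []\<close> by (intro mult_left_mono) auto
  finally show ?thesis
    by (simp add: algebra_simps)
qed

lemma singleton_le_del_append:
  assumes seqs: "S1 @ S2 \<in> seqs V"
    and ge: "\<And>a. a \<in> set S1 \<Longrightarrow> h [u] \<le> h [a]"
    and U: "finite U" "card U \<le> length S1" and u: "u \<in> set S2 \<inter> U"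
  shows "h [u] \<le> h ((S1 @ S2) \<ominus> U)"
proof -
  have "u \<notin> set S1" and "length S1 = card (set S1)"
    using seqs u by (auto simp: append_in_seqs_iff length_eq_card_seqs)
  then have "card U < card (insert u (set S1))"
    using U(2) by simp
  then have "\<not> insert u (set S1) \<subseteq> U"
    using card_mono[OF U(1), of "insert u (set S1)"] by linarith
  then obtain a where a: "a \<in> set S1" "a \<notin> U"
    using u by blast
  have "h [u] \<le> h [a]"
    using a(1) by (rule ge)
  also have "\<dots> \<le> h ((S1 @ S2) \<ominus> U)"
    using a by (intro singleton_le del_in_seqs[OF seqs]) simp
  finally show ?thesis .
qed

lemma le_del_append:
  assumes seqs: "S1 @ S2 \<in> seqs V" and "0 \<le> h []"
    and ge: "\<And>a u. a \<in> set S1 \<Longrightarrow> u \<in> set S2 \<Longrightarrow> h [u] \<le> h [a]"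
    and U: "finite U" "card U \<le> length S1"
  shows "h S2 \<le> (1 + real (card U)) * h ((S1 @ S2) \<ominus> U)"
proof -
  define D where "D = (S1 @ S2) \<ominus> U"
  have D: "D \<in> seqs V"
    unfolding D_def using seqs by (rule del_in_seqs)
  have "marginal h [u] [] \<le> h D" if u: "u \<in> set S2 \<inter> U" for u
    using singleton_le_del_append[OF seqs ge U u] u \<open>0 \<le> h []\<close> by (simp add: D_def marginal_def)
  then have "(\<Sum>u\<in>set S2 \<inter> U. marginal h [u] []) \<le> real (card (set S2 \<inter> U)) * h D"
    by (rule sum_bounded_above)
  also have "\<dots> \<le> real (card U) * h D"
    using U(1) \<open>0 \<le> h []\<close> Nil_le[OF D] by (intro mult_right_mono) (auto intro: card_mono)
  finally have "(\<Sum>u\<in>set S2 \<inter> U. marginal h [u] []) \<le> real (card U) * h D" .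
  moreover have "h S2 \<le> h (S2 \<ominus> U) + (\<Sum>u\<in>set S2 \<inter> U. marginal h [u] [])"
    using seq_concat_le_del_plus_marginals[OF submodular, of "[]" S2 U] seqs
    by (simp add: append_in_seqs_iff)
  moreover have "h (S2 \<ominus> U) \<le> h D"
    by (intro sublist_le[OF D]) (simp add: D_def del_append)
  ultimately show ?thesis
    by (simp add: D_def algebra_simps)
qed

lemma le_robust_value_append:
  assumes seqs: "S1 @ S2 \<in> seqs V" and "0 \<le> h []" and "\<tau> \<le> length S1"
    and ge: "\<And>a u. a \<in> set S1 \<Longrightarrow> u \<in> set S2 \<Longrightarrow> h [u] \<le> h [a]"
  shows "h S2 / (1 + real \<tau>) \<le> robust_value h \<tau> (S1 @ S2)"
  unfolding le_robust_value_iff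
proof (intro allI impI)
  fix U assume U: "U \<subseteq> set (S1 @ S2)" "card U \<le> \<tau>"
  have "0 \<le> h ((S1 @ S2) \<ominus> U)"
    using \<open>0 \<le> h []\<close> Nil_le[OF del_in_seqs[OF seqs], of U] by linarith
  have "h S2 \<le> (1 + real (card U)) * h ((S1 @ S2) \<ominus> U)"
    using seqs \<open>0 \<le> h []\<close> \<open>\<tau> \<le> length S1\<close> U by (intro le_del_append ge) (auto intro: finite_subset)
  also have "\<dots> \<le> (1 + real \<tau>) * h ((S1 @ S2) \<ominus> U)"
    using U(2) \<open>0 \<le> h ((S1 @ S2) \<ominus> U)\<close> by (intro mult_right_mono) auto
  finally show "h S2 / (1 + real \<tau>) \<le> h ((S1 @ S2) \<ominus> U)"
    by (simp add: divide_le_eq mult.commute)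
qed

lemma algorithm2_robust_value_ge:
  assumes "algorithm2_output V h k \<tau> S" and "0 \<le> h []" and T: "T \<in> seqs V" "length T \<le> k"
  shows "(1 - 1 / exp 1) / (1 + real \<tau>) * robust_value h \<tau> T \<le> robust_value h \<tau> S"
proof -
  obtain S1 S2 where S1: "greedy_list (\<lambda>_ v. h [v]) V S1" "length S1 = \<tau>"
    and S2: "greedy_list (\<lambda>S v. marginal h [v] S) (V - set S1) S2" "length S2 = k - \<tau>"
    and S: "S = S1 @ S2"
    using assms(1) by (rule algorithm2_outputE)
  note S1_seqs = greedy_list_in_seqs[OF S1(1)] and S2_seqs = greedy_list_in_seqs[OF S2(1)]
  obtain R where R: "R \<in> seqs (V - set S1)" "length R \<le> length T - \<tau>"
    and T_le_R: "robust_value h \<tau> T \<le> h R"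
    using robust_value_le_avoiding[of T V "set S1" \<tau> h] T(1) S1(2) length_eq_card_seqs[OF S1_seqs]
    by auto
  have "(1 - 1 / exp 1) * robust_value h \<tau> T \<le> (1 - 1 / exp 1) * h R"
    using T_le_R by (intro mult_left_mono) auto
  also have "\<dots> \<le> h S2"
    using S2 R T(2) \<open>0 \<le> h []\<close> by (intro greedy_list_value_ge) auto
  finally have "(1 - 1 / exp 1) * robust_value h \<tau> T / (1 + real \<tau>) \<le> h S2 / (1 + real \<tau>)"
    by (rule divide_right_mono) simp
  also have "\<dots> \<le> robust_value h \<tau> (S1 @ S2)"
  proof (rule le_robust_value_append)
    show "S1 @ S2 \<in> seqs V"
      using S1_seqs S2_seqs by (auto simp: seqs_def)
    show "h [u] \<le> h [a]" if "a \<in> set S1" "u \<in> set S2" for a u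
      using greedy_list_const_ge[OF S1(1)] that S2_seqs by (auto simp: seqs_def)
  qed (use S1(2) \<open>0 \<le> h []\<close> in auto)
  finally show ?thesis
    by (simp add: S)
qed

end

theorem theorem3:
  fixes V :: "'a set" and h :: "'a list \<Rightarrow> real" and k \<tau> :: nat and S :: "'a list"
  assumes "finite V"
    and "k \<ge> 2" and "1 \<le> \<tau>" and "\<tau> \<le> k" and "card V \<ge> k"
    and "\<forall>T \<in> seqs V. h T \<ge> 0"
    and "h [] = 0"
    and "forward_monotone V h"
    and "backward_monotone V h"
    and "general_sequence_submodular V h"
    and "algorithm2_output V h k \<tau> S"
  shows "robust_value h \<tau> S \<ge>
    (1 - 1 / exp 1) / (1 + real \<tau>) *
      Max (robust_value h \<tau> ` {S' \<in> seqs V. card (set S') \<le> k})"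
proof -
  interpret monotone_sequence_submodular V h
    using assms by unfold_locales
  let ?C = "{S' \<in> seqs V. card (set S') \<le> k}"
  have "finite ?C" and "[] \<in> ?C"
    using finite_seqs[OF \<open>finite V\<close>] by auto
  then have "Max (robust_value h \<tau> ` ?C) \<in> robust_value h \<tau> ` ?C"
    by (intro Max_in finite_imageI) blast+
  then obtain T where T: "T \<in> seqs V" "card (set T) \<le> k"
    and Max_eq: "Max (robust_value h \<tau> ` ?C) = robust_value h \<tau> T"
    by blast
  show ?thesis
    unfolding Max_eq using assms T
    by (intro algorithm2_robust_value_ge) (auto simp: length_eq_card_seqs)
qed

end
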